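(* Let $a=a(n)$ and $b=b(n)$ be positive integers. Then, for all sufficiently large $n$, the $(a:b)$ Maker-Breaker Connectivity game $\mathcal{T}_n$ is Maker's win provided one of the following holds: (1) $a=o\left(\sqrt{\frac{n}{\ln n}}\right)$ and $$b<\frac{a\left(n-\frac{n}{a\ln n}+\frac{a-1}{2}\ln\left(\frac{n}{a^2\ln n}\right)\right)}{\ln n+a+\ln\ln n+4};$$ (2) $a=\Omega\left(\sqrt{\frac{n}{\ln n}}\right)$, $a\le\frac{n-1}{2}$ and $b<\frac{an}{a+2\ln n-2\ln a+4}$.
   Context: In the $(a:b)$ Maker-Breaker Connectivity game $\mathcal{T}_n$, the board is the edge set of the complete graph $K_n$. Two players, Maker and Breaker, alternately claim previously unclaimed edges, Breaker going first; in each turn Breaker claims $b$ edges and then Maker claims $a$ edges, until every edge is claimed. Maker wins if, by the end of the game, the graph of his edges is a connected spanning subgraph of $K_n$; otherwise Breaker wins. The game is Maker's win if Maker has a strategy that wins against every strategy of Breaker. Asymptotic notation is with respect to $n\to\infty$; $\ln$ is the natural logarithm. *)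

theory Defs
  imports Complex_Main "HOL-Library.Landau_Symbols"
begin

text \<open>
  A history is the list of moves made so far (oldest first, Breaker's at the even positions),
  each move being the set of board elements claimed in that turn.
\<close>

type_synonym 'e strategy = "'e set list \<Rightarrow> 'e set"

text \<open>
  A player with bias \<open>k\<close> claims exactly \<open>k\<close> unclaimed elements, or all the remaining ones
  if there are fewer than \<open>k\<close>; this can only happen in the last nonempty turn.
\<close>

definition legal_strategy :: "'e set \<Rightarrow> nat \<Rightarrow> 'e strategy \<Rightarrow> bool" where
  "legal_strategy X k \<sigma> \<longleftrightarrow>
     (\<forall>h. \<sigma> h \<subseteq> X - \<Union>(set h) \<and> card (\<sigma> h) = min k (card (X - \<Union>(set h))))"

primrec play :: "'e strategy \<Rightarrow> 'e strategy \<Rightarrow> nat \<Rightarrow> 'e set list" where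
  "play \<sigma> \<tau> 0 = []"
| "play \<sigma> \<tau> (Suc i) =
     play \<sigma> \<tau> i @ [if even i then \<tau> (play \<sigma> \<tau> i) else \<sigma> (play \<sigma> \<tau> i)]"

text \<open>
  The play is continued indefinitely, but on a finite board with positive biases all moves
  after the board is exhausted are empty, so the following union is the set of
  elements Maker owns at the end of the game.
\<close>

definition maker_claims :: "'e strategy \<Rightarrow> 'e strategy \<Rightarrow> 'e set" where
  "maker_claims \<sigma> \<tau> = (\<Union>i. \<sigma> (play \<sigma> \<tau> (2 * i + 1)))"

definition makers_win :: "'e set \<Rightarrow> ('e set \<Rightarrow> bool) \<Rightarrow> nat \<Rightarrow> nat \<Rightarrow> bool" where
  "makers_win X W a b \<longleftrightarrow>
     (\<exists>\<sigma>. legal_strategy X a \<sigma> \<and>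
        (\<forall>\<tau>. legal_strategy X b \<tau> \<longrightarrow> W (maker_claims \<sigma> \<tau>)))"

definition complete_edges :: "nat \<Rightarrow> nat set set" where
  "complete_edges n = {e. e \<subseteq> {..<n} \<and> card e = 2}"

definition connected_spanning :: "nat \<Rightarrow> nat set set \<Rightarrow> bool" where
  "connected_spanning n E \<longleftrightarrow>
     E \<subseteq> complete_edges n \<and>
     (\<forall>u<n. \<forall>v<n. (u, v) \<in> {(x, y). {x, y} \<in> E}\<^sup>*)"

definition connectivity_makers_win :: "nat \<Rightarrow> nat \<Rightarrow> nat \<Rightarrow> bool" where
  "connectivity_makers_win n a b \<longleftrightarrow>
     makers_win (complete_edges n) (connected_spanning n) a b"

end

theory Submission
  imports Defs "HOL-Real_Asymp.Real_Asymp"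
begin

text \<open>
  Maker keeps one active vertex in every component of his graph. In each step he takes, among the
  active vertices of components with at most half of all vertices, one with the largest Breaker
  degree, joins its component to another one by any free edge, and deactivates that vertex.
  If he is blocked after the active vertices \<open>v 0, \<dots>, v (m - 1)\<close> have been
  picked, then \<open>v (m - 1)\<close> has Breaker degree close to \<open>n\<close>. By greediness the average
  Breaker degree of \<open>{v l, \<dots>, v (m - 1)}\<close> does not increase when \<open>v l\<close> is dropped, so it
  increases only through Breaker's moves, each of which adds at most
  \<open>(b + e) / (m - l)\<close>, where \<open>e\<close> counts the new edges inside the set. Early on
  \<open>e \<le> b\<close> is good enough; late in the game all such edges together contribute at most the
  size of the remaining set. Summing up harmonic series contradicts the bound on \<open>b\<close>.
\<close>

section \<open>Averaging Breaker degrees\<close>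

definition edge_degree :: "'v set set \<Rightarrow> 'v \<Rightarrow> nat" where
  "edge_degree B u = card {f \<in> B. u \<in> f}"

lemma card_filter_eq_sum: "finite A \<Longrightarrow> card {x \<in> A. P x} = (\<Sum>x\<in>A. if P x then 1 else 0)"
  by (simp add: sum.If_cases Collect_conj_eq)

lemma sum_edge_degree_le:
  fixes v :: "nat \<Rightarrow> 'v"
  assumes inj: "inj_on v J" and J: "finite J" and B: "finite B" "\<And>f. f \<in> B \<Longrightarrow> card f = 2"
  shows "(\<Sum>j\<in>J. edge_degree B (v j)) \<le> card B + card {f \<in> B. f \<subseteq> v ` J}"
proof -
  have "(\<Sum>j\<in>J. edge_degree B (v j)) = (\<Sum>j\<in>J. \<Sum>f\<in>B. if v j \<in> f then 1 else 0)"
    unfolding edge_degree_def using B by (simp add: card_filter_eq_sum)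
  also have "\<dots> = (\<Sum>f\<in>B. \<Sum>j\<in>J. if v j \<in> f then 1 else 0)"
    by (rule sum.swap)
  also have "\<dots> \<le> (\<Sum>f\<in>B. 1 + (if f \<subseteq> v ` J then 1 else 0))"
  proof (rule sum_mono)
    fix f assume f: "f \<in> B"
    let ?S = "{j \<in> J. v j \<in> f}"
    have fin: "finite f" using B(2)[OF f] by (metis card.infinite zero_neq_numeral)
    have inj': "inj_on v ?S" using inj by (rule inj_on_subset) auto
    have card_S: "card ?S = card (v ` ?S)" using inj' by (simp add: card_image)
    have le2: "card ?S \<le> 2"
      unfolding card_S B(2)[OF f, symmetric] by (rule card_mono) (use fin in auto)
    have "f \<subseteq> v ` J" if "card ?S = 2"
    proof -
      have "v ` ?S = f"
        by (rule card_subset_eq) (use fin that card_S B(2)[OF f] in auto)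
      then show ?thesis by auto
    qed
    then have "card ?S \<le> 1 + (if f \<subseteq> v ` J then 1 else 0)" using le2 by fastforce
    then show "(\<Sum>j\<in>J. if v j \<in> f then 1 else 0) \<le> (1::nat) + (if f \<subseteq> v ` J then 1 else 0)"
      using J by (simp add: card_filter_eq_sum)
  qed
  also have "\<dots> = card B + card {f \<in> B. f \<subseteq> v ` J}"
    unfolding sum.distrib using B by (simp add: card_filter_eq_sum)
  finally show ?thesis .
qed

lemma edge_degree_Un_le:
  "finite B \<Longrightarrow> finite B' \<Longrightarrow> edge_degree (B \<union> B') u \<le> edge_degree B u + edge_degree B' u"
proof -
  have "{f \<in> B \<union> B'. u \<in> f} = {f \<in> B. u \<in> f} \<union> {f \<in> B'. u \<in> f}" by auto
  then show ?thesis unfolding edge_degree_def by (simp add: card_Un_le)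
qed

lemma average_drop_max:
  fixes d :: "nat \<Rightarrow> real"
  assumes "Suc l < m" and "\<And>j. l \<le> j \<Longrightarrow> j < m \<Longrightarrow> d j \<le> d l"
  shows "(\<Sum>j=Suc l..<m. d j) / real (m - Suc l) \<le> (\<Sum>j=l..<m. d j) / real (m - l)"
proof -
  let ?S = "\<Sum>j=Suc l..<m. d j" and ?k = "real (m - Suc l)"
  have k: "?k > 0" "real (m - l) = ?k + 1" using assms(1) by auto
  have "?S \<le> (\<Sum>j=Suc l..<m. d l)" by (rule sum_mono) (use assms in auto)
  then have le: "?S \<le> ?k * d l" by simp
  have "(\<Sum>j=l..<m. d j) = d l + ?S" using assms(1) by (simp add: sum.atLeast_Suc_lessThan)
  moreover have "?S / ?k \<le> (d l + ?S) / (?k + 1)"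
    using k(1) le by (simp add: field_simps)
  ultimately show ?thesis using k by simp
qed

locale greedy_sequence =
  fixes v :: "nat \<Rightarrow> 'v" and X :: "nat \<Rightarrow> 'v set set" and m a b :: nat
  assumes a_pos: "0 < a"
    and inj: "inj_on v {..<m}"
    and finite_X: "finite (X r)"
    and disjoint_X: "r \<noteq> s \<Longrightarrow> X r \<inter> X s = {}"
    and edges_X: "f \<in> X r \<Longrightarrow> card f = 2"
    and card_X: "card (X r) \<le> b"
    and greedy: "l \<le> j \<Longrightarrow> j < m \<Longrightarrow>
        edge_degree (\<Union>i\<le>l div a. X i) (v j) \<le> edge_degree (\<Union>i\<le>l div a. X i) (v l)"
begin

definition inner :: "nat \<Rightarrow> 'v set set" where
  "inner r = {f \<in> X r. f \<subseteq> v ` {r * a..<m}}"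

lemma card_inner_le: "card (inner r) \<le> b"
  using card_mono[of "X r" "inner r"] finite_X[of r] card_X[of r] by (fastforce simp: inner_def)

lemma average_degree_le:
  "l < m \<Longrightarrow> (\<Sum>j=l..<m. real (edge_degree (\<Union>i\<le>l div a. X i) (v j))) / real (m - l)
     \<le> (\<Sum>r\<le>l div a. real (b + card (inner r)) / real (m - r * a))"
proof (induction l)
  case 0
  have "(\<Sum>j=0..<m. edge_degree (X 0) (v j)) \<le> card (X 0) + card {f \<in> X 0. f \<subseteq> v ` {0..<m}}"
    by (rule sum_edge_degree_le) (use inj finite_X edges_X in \<open>auto simp: atLeast0LessThan\<close>)
  also have "\<dots> \<le> b + card (inner 0)" using card_X[of 0] by (simp add: inner_def)
  finally have "real (\<Sum>j=0..<m. edge_degree (X 0) (v j)) \<le> real (b + card (inner 0))"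
    unfolding of_nat_le_iff .
  then show ?case by (simp add: divide_right_mono)
next
  case (Suc l)
  let ?B = "\<lambda>l. \<Union>i\<le>l div a. X i"
  have fin: "finite (?B l)" for l using finite_X by auto
  have drop: "(\<Sum>j=Suc l..<m. real (edge_degree (?B l) (v j))) / real (m - Suc l)
     \<le> (\<Sum>j=l..<m. real (edge_degree (?B l) (v j))) / real (m - l)"
    by (rule average_drop_max) (use Suc.prems greedy in auto)
  note IH = order.trans[OF drop Suc.IH[OF Suc_lessD[OF Suc.prems]]]
  show ?case
  proof (cases "a dvd Suc l")
    case False
    then have "Suc l div a = l div a" by (simp add: div_Suc mod_eq_0_iff_dvd)
    then show ?thesis using IH by simp
  next
    case True
    define r where "r = Suc l div a"
    have r: "Suc l = r * a" using True by (simp add: r_def)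
    have div: "Suc l div a = Suc (l div a)" using True by (simp add: div_Suc mod_eq_0_iff_dvd)
    have B: "?B (Suc l) = ?B l \<union> X r"
      unfolding div r_def by (auto simp: atMost_Suc)
    have "(\<Sum>j=Suc l..<m. edge_degree (?B (Suc l)) (v j))
        \<le> (\<Sum>j=Suc l..<m. edge_degree (?B l) (v j) + edge_degree (X r) (v j))"
      unfolding B by (intro sum_mono edge_degree_Un_le fin finite_X)
    also have "\<dots> = (\<Sum>j=Suc l..<m. edge_degree (?B l) (v j)) + (\<Sum>j=Suc l..<m. edge_degree (X r) (v j))"
      by (rule sum.distrib)
    also have "(\<Sum>j=Suc l..<m. edge_degree (X r) (v j)) \<le> card (X r) + card (inner r)"
      unfolding inner_def r
      by (rule sum_edge_degree_le) (use finite_X edges_X in \<open>auto intro!: inj_on_subset[OF inj]\<close>)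
    finally have "(\<Sum>j=Suc l..<m. edge_degree (?B (Suc l)) (v j))
        \<le> (\<Sum>j=Suc l..<m. edge_degree (?B l) (v j)) + (b + card (inner r))"
      using card_X[of r] by simp
    then have "(\<Sum>j=Suc l..<m. real (edge_degree (?B (Suc l)) (v j)))
        \<le> (\<Sum>j=Suc l..<m. real (edge_degree (?B l) (v j))) + real (b + card (inner r))"
      unfolding of_nat_sum[symmetric] of_nat_add[symmetric] of_nat_le_iff .
    then have "(\<Sum>j=Suc l..<m. real (edge_degree (?B (Suc l)) (v j))) / real (m - Suc l)
        \<le> (\<Sum>j=Suc l..<m. real (edge_degree (?B l) (v j))) / real (m - Suc l)
           + real (b + card (inner r)) / real (m - Suc l)"
      by (simp add: add_divide_distrib[symmetric] divide_right_mono)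
    also have "\<dots> \<le> (\<Sum>r\<le>l div a. real (b + card (inner r)) / real (m - r * a))
           + real (b + card (inner r)) / real (m - r * a)"
      using IH unfolding r by simp
    also have "\<dots> = (\<Sum>r\<le>Suc l div a. real (b + card (inner r)) / real (m - r * a))"
      unfolding div using r_def div by simp
    finally show ?thesis .
  qed
qed

text \<open>
  An inner edge \<open>{v i, v j}\<close> with \<open>i < j\<close> is charged \<open>1 / (m - i)\<close>, which is at least its
  share \<open>1 / (m - r * a)\<close> in whatever round \<open>r\<close> it was claimed; there are \<open>m - Suc i\<close>
  pairs with smaller index \<open>i\<close>.
\<close>

lemma sum_inner_late_le:
  assumes m: "R0 * a < m"
  shows "(\<Sum>r\<in>{R0..(m - 1) div a}. real (card (inner r)) / real (m - r * a)) \<le> real (m - R0 * a - 1)"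
proof -
  let ?I = "{R0..(m - 1) div a}"
  let ?P = "SIGMA i:{R0 * a..<m}. {Suc i..<m}"
  define rnd where "rnd f = (THE r. f \<in> X r)" for f
  have rnd: "rnd f = r" if "f \<in> X r" for f r
    unfolding rnd_def using that disjoint_X by (intro the_equality) blast+
  have fin: "finite (inner r)" for r using finite_X[of r] by (simp add: inner_def)
  have "(\<Sum>r\<in>?I. real (card (inner r)) / real (m - r * a))
      = (\<Sum>r\<in>?I. \<Sum>f\<in>inner r. 1 / real (m - r * a))" by simp
  also have "\<dots> = (\<Sum>(r, f)\<in>Sigma ?I inner. 1 / real (m - r * a))"
    using fin by (subst sum.Sigma) auto
  also have "\<dots> \<le> (\<Sum>(i, j)\<in>?P. 1 / real (m - i))"
  proof (rule sum_le_included[where i = "\<lambda>(i, j). (rnd {v i, v j}, {v i, v j})"])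
    show "\<forall>x\<in>Sigma ?I inner. \<exists>y\<in>?P. (case y of (i, j) \<Rightarrow> (rnd {v i, v j}, {v i, v j})) = x
       \<and> (case x of (r, f) \<Rightarrow> 1 / real (m - r * a)) \<le> (case y of (i, j) \<Rightarrow> 1 / real (m - i))"
    proof safe
      fix r f assume r: "r \<in> ?I" and f: "f \<in> inner r"
      have fX: "f \<in> X r" and fv: "f \<subseteq> v ` {r * a..<m}" using f by (auto simp: inner_def)
      obtain x y where xy: "f = {x, y}" "x \<noteq> y" using edges_X[OF fX] by (auto simp: card_2_iff)
      obtain i j where ij: "f = {v i, v j}" "i < j" "r * a \<le> i" "j < m"
      proof -
        obtain i where i: "x = v i" "i \<in> {r * a..<m}" using fv xy by auto
        obtain j where j: "y = v j" "j \<in> {r * a..<m}" using fv xy by auto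
        have "i \<noteq> j" using xy i j by auto
        then show ?thesis using that[of i j] that[of j i] i j xy by (cases "i < j") auto
      qed
      have "R0 * a \<le> i" using r ij(3) by (auto intro: order.trans mult_le_mono1)
      then have "(i, j) \<in> ?P" using ij by (auto intro: order.trans)
      moreover have "1 / real (m - r * a) \<le> 1 / real (m - i)"
      proof (rule frac_le)
        show "real (m - i) \<le> real (m - r * a)" unfolding of_nat_le_iff using ij by simp
        show "0 < real (m - i)" using ij by simp
      qed simp_all
      ultimately show "\<exists>y\<in>?P. (case y of (i, j) \<Rightarrow> (rnd {v i, v j}, {v i, v j})) = (r, f)
       \<and> 1 / real (m - r * a) \<le> (case y of (i, j) \<Rightarrow> 1 / real (m - i))"
        using rnd[OF fX] ij(1) by (intro bexI[of _ "(i, j)"]) auto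
    qed
    show "finite (Sigma ?I inner)" using fin by (intro finite_SigmaI) simp_all
  qed auto
  also have "\<dots> = (\<Sum>i\<in>{R0 * a..<m}. \<Sum>j\<in>{Suc i..<m}. 1 / real (m - i))"
    by (subst sum.Sigma) auto
  also have "\<dots> = (\<Sum>i\<in>{R0 * a..<m}. real (m - Suc i) / real (m - i))" by simp
  also have "\<dots> \<le> (\<Sum>i\<in>{R0 * a..<m}. if Suc i = m then 0 else 1)"
    by (rule sum_mono) (auto simp: divide_simps)
  also have "\<dots> = real (card ({R0 * a..<m} \<inter> - {i. Suc i = m}))"
    by (simp add: sum.If_cases)
  also have "{R0 * a..<m} \<inter> - {i. Suc i = m} = {R0 * a..<m - 1}" using m by auto
  finally show ?thesis by (simp add: diff_right_commute)
qed

lemma last_degree_le: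
  assumes m: "R0 * a < m"
  shows "real (edge_degree (\<Union>i\<le>(m - 1) div a. X i) (v (m - 1)))
     \<le> real b * (\<Sum>r\<le>(m - 1) div a. 1 / real (m - r * a))
       + real b * (\<Sum>r<R0. 1 / real (m - r * a)) + real (m - R0 * a - 1)"
proof -
  let ?R = "(m - 1) div a"
  have R: "R0 \<le> ?R" using m a_pos by (simp add: less_eq_div_iff_mult_less_eq)
  have split: "{..?R} = {..<R0} \<union> {R0..?R}" using R by auto
  have "m - 1 < m" and sing: "{m - 1..<m} = {m - 1}" using m by auto
  from average_degree_le[OF this(1)]
  have "real (edge_degree (\<Union>i\<le>?R. X i) (v (m - 1)))
     \<le> (\<Sum>r\<le>?R. real (b + card (inner r)) / real (m - r * a))"
    unfolding sing using m by simp
  also have "\<dots> = real b * (\<Sum>r\<le>?R. 1 / real (m - r * a)) + (\<Sum>r\<le>?R. real (card (inner r)) / real (m - r * a))"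
    by (simp add: add_divide_distrib sum.distrib sum_distrib_left)
  also have "(\<Sum>r\<le>?R. real (card (inner r)) / real (m - r * a))
     = (\<Sum>r<R0. real (card (inner r)) / real (m - r * a)) + (\<Sum>r\<in>{R0..?R}. real (card (inner r)) / real (m - r * a))"
    unfolding split by (rule sum.union_disjoint) auto
  also have "(\<Sum>r<R0. real (card (inner r)) / real (m - r * a)) \<le> (\<Sum>r<R0. real b / real (m - r * a))"
    by (intro sum_mono divide_right_mono) (use card_inner_le in auto)
  also have "\<dots> = real b * (\<Sum>r<R0. 1 / real (m - r * a))" by (simp add: sum_distrib_left)
  finally show ?thesis using sum_inner_late_le[OF m] by linarith
qed

end

section \<open>Maker's strategy\<close>

definition free_edges :: "nat \<Rightarrow> nat set set \<Rightarrow> nat set set \<Rightarrow> nat set set" where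
  "free_edges n B M = complete_edges n - B - M"

definition candidates :: "nat \<Rightarrow> (nat \<Rightarrow> nat) \<Rightarrow> nat set" where
  "candidates n c = {w \<in> c ` {..<n}. 2 * card {u. u < n \<and> c u = w} \<le> n}"

definition pick :: "nat \<Rightarrow> nat set set \<Rightarrow> (nat \<Rightarrow> nat) \<Rightarrow> nat" where
  "pick n B c = arg_max (edge_degree B) (\<lambda>w. w \<in> candidates n c)"

definition crossing :: "nat \<Rightarrow> nat set set \<Rightarrow> nat set set \<Rightarrow> (nat \<Rightarrow> nat) \<Rightarrow> nat \<Rightarrow> nat set set" where
  "crossing n B M c w = {e \<in> free_edges n B M. \<exists>x\<in>e. \<exists>y\<in>e. c x = w \<and> c y \<noteq> w}"

text \<open>
  A state \<open>(M, c)\<close> consists of Maker's edges and the map sending a vertex to the active vertex of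
  its component. If no useful edge is free, the step still claims an arbitrary free
  edge, so that Maker's moves always have the required size.
\<close>

fun maker_step :: "nat \<Rightarrow> nat set set \<Rightarrow> nat set set \<times> (nat \<Rightarrow> nat) \<Rightarrow> nat set set \<times> (nat \<Rightarrow> nat)" where
  "maker_step n B (M, c) =
     (let F = free_edges n B M; w = pick n B c; D = crossing n B M c w;
          e = (SOME e. e \<in> (if D = {} then F else D));
          w' = c (SOME y. y \<in> e \<and> c y \<noteq> w)
      in (if F = {} then M else insert e M, \<lambda>u. if c u = w then w' else c u))"

text \<open>\<open>X i\<close> is Breaker's move of round \<open>i\<close>, and \<open>l\<close> counts single edges claimed by Maker.\<close>

primrec maker_state :: "nat \<Rightarrow> nat \<Rightarrow> (nat \<Rightarrow> nat set set) \<Rightarrow> nat \<Rightarrow> nat set set \<times> (nat \<Rightarrow> nat)" where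
  "maker_state n a X 0 = ({}, id)"
| "maker_state n a X (Suc l) = maker_step n (\<Union>i\<le>l div a. X i) (maker_state n a X l)"

abbreviation maker_edges where "maker_edges n a X l \<equiv> fst (maker_state n a X l)"
abbreviation labels where "labels n a X l \<equiv> snd (maker_state n a X l)"

lemma finite_complete_edges: "finite (complete_edges n)"
  unfolding complete_edges_def by (rule finite_subset[of _ "Pow {..<n}"]) auto

lemma maker_step_edges:
  "free_edges n B M = {} \<and> fst (maker_step n B (M, c)) = M \<or>
   (\<exists>e\<in>free_edges n B M. fst (maker_step n B (M, c)) = insert e M)"
proof (cases "free_edges n B M = {}")
  case False
  let ?D = "crossing n B M c (pick n B c)"
  let ?E = "if ?D = {} then free_edges n B M else ?D"
  define e where "e = (SOME e. e \<in> ?E)"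
  have "?E \<noteq> {}" using False by simp
  then have "e \<in> ?E" unfolding e_def by (rule some_in_eq[THEN iffD2])
  moreover have "?E \<subseteq> free_edges n B M" by (auto simp: crossing_def)
  ultimately have "e \<in> free_edges n B M" by (rule rev_subsetD)
  moreover have "fst (maker_step n B (M, c)) = insert e M"
    unfolding maker_step.simps Let_def fst_conv e_def using False by (rule if_not_P)
  ultimately show ?thesis by blast
next
  case True
  then have "fst (maker_step n B (M, c)) = M"
    unfolding maker_step.simps Let_def fst_conv by (rule if_P)
  then show ?thesis using True by blast
qed

lemma maker_step_good:
  assumes "crossing n B M c (pick n B c) \<noteq> {}" (is "?D \<noteq> {}")
  obtains x y where "x < n" "y < n" "c x = pick n B c" "c y \<noteq> pick n B c"
    "maker_step n B (M, c) = (insert {x, y} M, \<lambda>u. if c u = pick n B c then c y else c u)"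
proof -
  define e where "e = (SOME e. e \<in> ?D)"
  have e: "e \<in> ?D" unfolding e_def using assms by (rule some_in_eq[THEN iffD2])
  then obtain x y where xy: "x \<in> e" "y \<in> e" "c x = pick n B c" "c y \<noteq> pick n B c"
    and free: "e \<in> free_edges n B M" by (auto simp: crossing_def)
  have "e \<subseteq> {..<n}" "card e = 2" using free by (auto simp: free_edges_def complete_edges_def)
  then have e_eq: "e = {x, y}" using xy by (auto simp: card_2_iff)
  have y: "(SOME y. y \<in> e \<and> c y \<noteq> pick n B c) = y"
    using xy unfolding e_eq by (intro some_equality) auto
  have F: "free_edges n B M \<noteq> {}" using free by blast
  have "maker_step n B (M, c) = (insert {x, y} M, \<lambda>u. if c u = pick n B c then c y else c u)"
    unfolding maker_step.simps Let_def if_not_P[OF assms] if_not_P[OF F] e_def[symmetric] y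
    unfolding e_eq ..
  then show ?thesis using that[of x y] xy \<open>e \<subseteq> {..<n}\<close> by auto
qed

lemma pick_candidate:
  assumes "candidates n c \<noteq> {}" "finite B"
  shows "pick n B c \<in> candidates n c"
    and "\<And>w. w \<in> candidates n c \<Longrightarrow> edge_degree B w \<le> edge_degree B (pick n B c)"
proof -
  obtain w where w: "w \<in> candidates n c" using assms by auto
  have "edge_degree B w < Suc (card B)" for w
    unfolding edge_degree_def using assms(2) by (simp add: card_mono le_imp_less_Suc)
  then have "pick n B c \<in> candidates n c \<and>
     (\<forall>w. w \<in> candidates n c \<longrightarrow> edge_degree B w \<le> edge_degree B (pick n B c))"
    unfolding pick_def using w by (intro arg_max_nat_lemma) auto
  then show "pick n B c \<in> candidates n c"
    and "\<And>w. w \<in> candidates n c \<Longrightarrow> edge_degree B w \<le> edge_degree B (pick n B c)" by auto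
qed

lemma maker_edges_Suc:
  "let F = free_edges n (\<Union>i\<le>l div a. X i) (maker_edges n a X l) in
     F = {} \<and> maker_edges n a X (Suc l) = maker_edges n a X l \<or>
     (\<exists>e\<in>F. maker_edges n a X (Suc l) = insert e (maker_edges n a X l))"
  using maker_step_edges[of n "\<Union>i\<le>l div a. X i" "maker_edges n a X l" "labels n a X l"]
  unfolding prod.collapse maker_state.simps Let_def .

lemma maker_edges_subset: "maker_edges n a X l \<subseteq> complete_edges n"
proof (induction l)
  case (Suc l)
  then show ?case using maker_edges_Suc[of n X l a] by (auto simp: Let_def free_edges_def)
qed simp

lemma maker_edges_turn:
  fixes n a i s :: nat and X :: "nat \<Rightarrow> nat set set"
  assumes "0 < a" "s \<le> a"
  defines "F \<equiv> free_edges n (\<Union>j\<le>i. X j) (maker_edges n a X (i * a))"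
  shows "maker_edges n a X (i * a) \<subseteq> maker_edges n a X (i * a + s) \<and>
    maker_edges n a X (i * a + s) - maker_edges n a X (i * a) \<subseteq> F \<and>
    card (maker_edges n a X (i * a + s) - maker_edges n a X (i * a)) = min s (card F)"
  using assms(2)
proof (induction s)
  case (Suc s)
  let ?M = "maker_edges n a X"
  let ?D = "?M (i * a + s) - ?M (i * a)"
  have IH: "?M (i * a) \<subseteq> ?M (i * a + s)" "?D \<subseteq> F" "card ?D = min s (card F)"
    using Suc by simp_all
  have finF: "finite F" unfolding F_def free_edges_def using finite_complete_edges by auto
  then have finD: "finite ?D" using IH(2) finite_subset by auto
  have div: "(i * a + s) div a = i" using Suc.prems assms(1) by (simp add: div_mult_self3)
  have F': "free_edges n (\<Union>j\<le>(i * a + s) div a. X j) (?M (i * a + s)) = F - ?D"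
    unfolding F_def div free_edges_def using IH(1) by auto
  have card: "card (F - ?D) = card F - card ?D" using finD IH(2) by (rule card_Diff_subset)
  from maker_edges_Suc[of n X "i * a + s" a, unfolded F' Let_def]
  consider "F - ?D = {}" "?M (Suc (i * a + s)) = ?M (i * a + s)"
    | e where "e \<in> F - ?D" "?M (Suc (i * a + s)) = insert e (?M (i * a + s))" by blast
  then show ?case
  proof cases
    case 1
    have "card F - card ?D = 0" unfolding card[symmetric] 1(1) by simp
    then have "min s (card F) = min (Suc s) (card F)" using IH(3) by linarith
    then show ?thesis using 1(2) IH by simp
  next
    case 2
    have "e \<notin> ?M (i * a)" using 2(1) by (auto simp: F_def free_edges_def)
    then have eq: "?M (i * a + Suc s) - ?M (i * a) = insert e ?D" using 2(2) by auto
    have "card (F - ?D) > 0" using 2(1) finF by (metis card_gt_0_iff empty_iff finite_Diff)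
    then have "Suc (min s (card F)) = min (Suc s) (card F)" using card IH(3) by linarith
    moreover have "card (insert e ?D) = Suc (card ?D)" using 2(1) finD by simp
    moreover have "insert e ?D \<subseteq> F" using 2(1) IH(2) by auto
    moreover have "?M (i * a) \<subseteq> ?M (i * a + Suc s)" using 2(2) IH(1) by auto
    ultimately show ?thesis unfolding eq using IH(3) by simp
  qed
qed simp

lemma maker_edges_mono: "l \<le> l' \<Longrightarrow> maker_edges n a X l \<subseteq> maker_edges n a X l'"
proof (induction l' rule: dec_induct)
  case (step l')
  then show ?case using maker_edges_Suc[of n X l' a] by (auto simp: Let_def)
qed simp

lemma maker_state_cong:
  assumes "\<And>i. i < k \<Longrightarrow> X i = Y i"
  shows "l \<le> k * a \<Longrightarrow> maker_state n a X l = maker_state n a Y l"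
proof (induction l)
  case (Suc l)
  then have "l div a < k" by (simp add: less_mult_imp_div_less)
  then have "(\<Union>i\<le>l div a. X i) = (\<Union>i\<le>l div a. Y i)" using assms by auto
  then show ?case using Suc by simp
qed simp

text \<open>
  The states are recomputed from Breaker's moves, which stand at the even positions of the history.
  The last branch is only there for legality: it concerns histories in which Maker did not follow
  the strategy.
\<close>

definition maker_strategy :: "nat \<Rightarrow> nat \<Rightarrow> nat set strategy" where
  "maker_strategy n a h =
     (let F = complete_edges n - \<Union>(set h);
          S = maker_edges n a (\<lambda>j. h ! (2 * j)) ((length h + 1) div 2 * a) - \<Union>(set h)
      in if card S = min a (card F) then S else (SOME S. S \<subseteq> F \<and> card S = min a (card F)))"

lemma legal_maker_strategy: "legal_strategy (complete_edges n) a (maker_strategy n a)"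
  unfolding legal_strategy_def
proof
  fix h :: "nat set set list"
  let ?F = "complete_edges n - \<Union>(set h)"
  have "\<exists>S. S \<subseteq> ?F \<and> card S = min a (card ?F)"
    by (meson min.cobounded2 obtain_subset_with_card_n)
  then have "(SOME S. S \<subseteq> ?F \<and> card S = min a (card ?F)) \<subseteq> ?F \<and>
     card (SOME S. S \<subseteq> ?F \<and> card S = min a (card ?F)) = min a (card ?F)"
    by (rule someI_ex)
  then show "maker_strategy n a h \<subseteq> ?F \<and> card (maker_strategy n a h) = min a (card ?F)"
    unfolding maker_strategy_def Let_def
    using maker_edges_subset[of n a "\<lambda>j. h ! (2 * j)" "(length h + 1) div 2 * a"] by auto
qed

lemma length_play [simp]: "length (play \<sigma> \<tau> N) = N"
  by (induction N) auto

lemma nth_play: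
  "j < N \<Longrightarrow> play \<sigma> \<tau> N ! j = (if even j then \<tau> (play \<sigma> \<tau> j) else \<sigma> (play \<sigma> \<tau> j))"
proof (induction N)
  case (Suc N)
  then show ?case by (cases "j = N") (simp_all add: nth_append)
qed simp

context
  fixes n a :: nat and \<tau> :: "nat set strategy" and X :: "nat \<Rightarrow> nat set set"
  assumes a: "0 < a"
  defines "X \<equiv> \<lambda>i. \<tau> (play (maker_strategy n a) \<tau> (2 * i))"
begin

lemma Union_play_even:
  "\<Union>(set (play (maker_strategy n a) \<tau> (2 * i))) = maker_edges n a X (i * a) \<union> (\<Union>j<i. X j)"
    (is "?U i")
  and maker_strategy_play:
  "maker_strategy n a (play (maker_strategy n a) \<tau> (2 * i + 1))
     = maker_edges n a X (Suc i * a) - maker_edges n a X (i * a)" (is "?S i")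
proof -
  let ?p = "play (maker_strategy n a) \<tau>"
  have S: "?S i" if "?U i" for i
  proof -
    have U: "\<Union>(set (?p (2 * i + 1))) = maker_edges n a X (i * a) \<union> (\<Union>j\<le>i. X j)"
      using that by (auto simp: X_def lessThan_Suc_atMost[symmetric] lessThan_Suc)
    have "maker_state n a (\<lambda>j. ?p (2 * i + 1) ! (2 * j)) (Suc i * a) = maker_state n a X (Suc i * a)"
      by (rule maker_state_cong[of "Suc i"]) (auto simp: nth_play X_def simp del: play.simps)
    then have eq: "maker_edges n a (\<lambda>j. ?p (2 * i + 1) ! (2 * j)) ((length (?p (2 * i + 1)) + 1) div 2 * a)
        = maker_edges n a X (Suc i * a)" by simp
    note turn = maker_edges_turn[OF a order.refl, where n = n and i = i and X = X]
    have D: "maker_edges n a X (Suc i * a) - \<Union>(set (?p (2 * i + 1)))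
        = maker_edges n a X (Suc i * a) - maker_edges n a X (i * a)"
      unfolding U using turn by (auto simp: free_edges_def add.commute)
    have F: "complete_edges n - \<Union>(set (?p (2 * i + 1)))
        = free_edges n (\<Union>j\<le>i. X j) (maker_edges n a X (i * a))"
      unfolding U free_edges_def by auto
    show "?S i"
      unfolding maker_strategy_def[of n a "?p (2 * i + 1)"] eq Let_def D F using turn by (simp add: add.commute)
  qed
  show U: "?U i"
  proof (induction i)
    case (Suc i)
    have "\<Union>(set (?p (2 * Suc i))) = \<Union>(set (?p (2 * i))) \<union> X i \<union> maker_strategy n a (?p (2 * i + 1))"
      by (auto simp: X_def)
    also have "\<dots> = maker_edges n a X (Suc i * a) \<union> (\<Union>j<Suc i. X j)"
      unfolding Suc S[OF Suc] using maker_edges_mono[of "i * a" "Suc i * a" n a X]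
      by (auto simp: less_Suc_eq)
    finally show ?case .
  qed simp
  show "?S i" using S[OF U] .
qed

lemma maker_edges_subset_claims: "maker_edges n a X l \<subseteq> maker_claims (maker_strategy n a) \<tau>"
proof -
  have "maker_edges n a X (i * a) \<subseteq> maker_claims (maker_strategy n a) \<tau>" for i
  proof (induction i)
    case (Suc i)
    then show ?case using maker_strategy_play[of i] unfolding maker_claims_def by blast
  qed simp
  moreover have "maker_edges n a X l \<subseteq> maker_edges n a X (l * a)"
    by (rule maker_edges_mono) (use a in simp)
  ultimately show ?thesis by blast
qed

end

section \<open>A blocked run\<close>

declare maker_state.simps(2) [simp del]

lemma sym_adjacency: "sym {(x, y). {x, y} \<in> M}"
  by (auto simp: sym_def insert_commute)

locale maker_run =
  fixes n a b :: nat and X :: "nat \<Rightarrow> nat set set"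
  assumes a_pos: "0 < a"
    and X_subset: "X r \<subseteq> complete_edges n"
    and X_disjoint: "r \<noteq> s \<Longrightarrow> X r \<inter> X s = {}"
    and card_X: "card (X r) \<le> b"
begin

abbreviation "breaker l \<equiv> \<Union>i\<le>l div a. X i"
abbreviation "medges \<equiv> maker_edges n a X"
abbreviation "lab \<equiv> labels n a X"
definition "target l = pick n (breaker l) (lab l)"

definition good_step :: "nat \<Rightarrow> bool" where
  "good_step l \<longleftrightarrow> candidates n (lab l) \<noteq> {} \<and>
     crossing n (breaker l) (medges l) (lab l) (target l) \<noteq> {}"

lemma finite_breaker: "finite (breaker l)"
  using X_subset finite_subset[OF _ finite_complete_edges] by blast

lemma target_candidate: "candidates n (lab l) \<noteq> {} \<Longrightarrow> target l \<in> candidates n (lab l)"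
  unfolding target_def by (rule pick_candidate[OF _ finite_breaker])

lemma good_step_update:
  assumes "good_step l"
  obtains x y where "x < n" "y < n" "lab l x = target l" "lab l y \<noteq> target l"
    "medges (Suc l) = insert {x, y} (medges l)"
    "lab (Suc l) = (\<lambda>u. if lab l u = target l then lab l y else lab l u)"
proof -
  have "crossing n (breaker l) (medges l) (lab l) (pick n (breaker l) (lab l)) \<noteq> {}"
    using assms unfolding good_step_def target_def by blast
  then obtain x y where "x < n" "y < n" "lab l x = target l" "lab l y \<noteq> target l"
    and "maker_step n (breaker l) (medges l, lab l)
      = (insert {x, y} (medges l), \<lambda>u. if lab l u = target l then lab l y else lab l u)"
    unfolding target_def by (rule maker_step_good)
  then show ?thesis using that[of x y] by (simp add: maker_state.simps(2))
qed

definition invariant :: "nat \<Rightarrow> bool" where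
  "invariant l \<longleftrightarrow>
     (\<forall>x y. {x, y} \<in> medges l \<longrightarrow> lab l x = lab l y) \<and>
     (\<forall>u<n. lab l u < n \<and> lab l (lab l u) = lab l u \<and>
        (u, lab l u) \<in> {(x, y). {x, y} \<in> medges l}\<^sup>*) \<and>
     card (lab l ` {..<n}) + l = n"

lemma invariant_Suc:
  assumes inv: "invariant l" and good: "good_step l"
  shows "invariant (Suc l)"
proof -
  obtain x y where xy: "x < n" "y < n" "lab l x = target l" "lab l y \<noteq> target l"
    and M: "medges (Suc l) = insert {x, y} (medges l)"
    and c: "lab (Suc l) = (\<lambda>u. if lab l u = target l then lab l y else lab l u)"
    by (rule good_step_update[OF good])
  let ?E = "\<lambda>M. {(x, y). {x, y} \<in> M}"
  have edge: "lab l x' = lab l y'" if "{x', y'} \<in> medges l" for x' y'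
    using inv that by (auto simp: invariant_def)
  have lab: "lab l u < n" "lab l (lab l u) = lab l u" "(u, lab l u) \<in> (?E (medges l))\<^sup>*" if "u < n" for u
    using inv that by (auto simp: invariant_def)
  have mono: "(?E (medges l))\<^sup>* \<subseteq> (?E (medges (Suc l)))\<^sup>*"
    unfolding M by (rule rtrancl_mono) auto
  have sym: "(v, u) \<in> (?E (medges l))\<^sup>*" if "(u, v) \<in> (?E (medges l))\<^sup>*" for u v
    using sym_rtrancl[OF sym_adjacency] that by (rule symD)
  have reach: "(u, lab (Suc l) u) \<in> (?E (medges (Suc l)))\<^sup>*" if u: "u < n" for u
  proof (cases "lab l u = target l")
    case True
    have "(u, target l) \<in> (?E (medges l))\<^sup>*" using lab(3)[OF u] True by simp
    moreover have "(target l, x) \<in> (?E (medges l))\<^sup>*" using sym[OF lab(3)[OF xy(1)]] xy(3) by simp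
    ultimately have "(u, x) \<in> (?E (medges (Suc l)))\<^sup>*" using mono by (meson rtrancl_trans subsetD)
    moreover have "(x, y) \<in> ?E (medges (Suc l))" unfolding M by simp
    moreover have "(y, lab l y) \<in> (?E (medges (Suc l)))\<^sup>*" using lab(3)[OF xy(2)] mono by blast
    ultimately have "(u, lab l y) \<in> (?E (medges (Suc l)))\<^sup>*"
      by (meson rtrancl.rtrancl_into_rtrancl rtrancl_trans)
    then show ?thesis unfolding c using True by simp
  next
    case False
    then show ?thesis unfolding c using lab(3)[OF u] mono by auto
  qed
  have image: "lab (Suc l) ` {..<n} = lab l ` {..<n} - {target l}"
  proof
    show "lab (Suc l) ` {..<n} \<subseteq> lab l ` {..<n} - {target l}" unfolding c using xy by auto
    show "lab l ` {..<n} - {target l} \<subseteq> lab (Suc l) ` {..<n}"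
      unfolding c by (auto simp: image_iff)
  qed
  have "target l \<in> lab l ` {..<n}" using xy by (metis imageI lessThan_iff)
  then have "Suc (card (lab (Suc l) ` {..<n})) = card (lab l ` {..<n})"
    unfolding image by (metis card_Suc_Diff1 finite_imageI finite_lessThan)
  then have "card (lab (Suc l) ` {..<n}) + Suc l = n" using inv by (auto simp: invariant_def)
  moreover have "lab (Suc l) u < n \<and> lab (Suc l) (lab (Suc l) u) = lab (Suc l) u" if "u < n" for u
    unfolding c using lab(1,2)[OF that] lab(1,2)[OF xy(2)] xy(4) by auto
  moreover have "lab (Suc l) x' = lab (Suc l) y'" if "{x', y'} \<in> medges (Suc l)" for x' y'
    using that edge[of x' y'] xy(3,4) unfolding M c by (auto simp: doubleton_eq_iff)
  ultimately show ?thesis unfolding invariant_def using reach by blast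
qed

lemma invariant_good: "(\<And>l'. l' < l \<Longrightarrow> good_step l') \<Longrightarrow> invariant l"
proof (induction l)
  case 0
  then show ?case by (simp add: invariant_def)
next
  case (Suc l)
  then show ?case by (simp add: invariant_Suc)
qed

lemma candidates_good_step:
  assumes "good_step l"
  shows "candidates n (lab (Suc l)) \<subseteq> candidates n (lab l) - {target l}"
proof
  fix w assume w: "w \<in> candidates n (lab (Suc l))"
  obtain x y where xy: "y < n" "lab l y \<noteq> target l"
    and c: "lab (Suc l) = (\<lambda>u. if lab l u = target l then lab l y else lab l u)"
    by (rule good_step_update[OF assms])
  obtain u where u: "u < n" "w = lab (Suc l) u" using w unfolding candidates_def by blast
  have w_eq: "w = (if lab l u = target l then lab l y else lab l u)" unfolding u(2) c ..
  then have ne: "w \<noteq> target l" using xy(2) by presburger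
  have im: "w \<in> lab l ` {..<n}"
    unfolding w_eq using imageI[of y "{..<n}" "lab l"] imageI[of u "{..<n}" "lab l"] u(1) xy(1) by simp
  have "card {u. u < n \<and> lab l u = w} \<le> card {u. u < n \<and> lab (Suc l) u = w}"
    by (rule card_mono) (use ne in \<open>auto simp: c\<close>)
  moreover have "2 * card {u. u < n \<and> lab (Suc l) u = w} \<le> n"
    using w unfolding candidates_def by blast
  ultimately show "w \<in> candidates n (lab l) - {target l}"
    using ne im unfolding candidates_def by simp
qed

lemma candidates_antimono:
  assumes "\<And>i. i < j \<Longrightarrow> good_step i" and "l \<le> j"
  shows "candidates n (lab j) \<subseteq> candidates n (lab l)"
  using assms(2,1)
proof (induction j rule: dec_induct)
  case (step j)
  then show ?case using candidates_good_step[of j] by fastforce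
qed simp

lemma connected_if_no_candidates:
  assumes inv: "invariant l" and none: "candidates n (lab l) = {}"
  shows "connected_spanning n (medges l)"
proof -
  have eq: "lab l u = lab l v" if uv: "u < n" "v < n" for u v
  proof (rule ccontr)
    assume ne: "lab l u \<noteq> lab l v"
    let ?C = "\<lambda>w. {x. x < n \<and> lab l x = w}"
    have "card (?C (lab l u)) + card (?C (lab l v)) = card (?C (lab l u) \<union> ?C (lab l v))"
      using ne by (intro card_Un_disjoint[symmetric]) auto
    also have "\<dots> \<le> card {..<n}" by (rule card_mono) auto
    finally have "2 * card (?C (lab l u)) \<le> n \<or> 2 * card (?C (lab l v)) \<le> n" by simp linarith
    then have "lab l u \<in> candidates n (lab l) \<or> lab l v \<in> candidates n (lab l)"
      using uv by (auto simp: candidates_def)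
    then show False using none by blast
  qed
  have "(u, v) \<in> {(x, y). {x, y} \<in> medges l}\<^sup>*" if uv: "u < n" "v < n" for u v
  proof -
    let ?R = "{(x, y). {x, y} \<in> medges l}\<^sup>*"
    have "(u, lab l u) \<in> ?R" "(v, lab l u) \<in> ?R"
      using inv uv eq[OF uv] by (auto simp: invariant_def)
    from this(2) have "(lab l u, v) \<in> ?R" by (rule symD[OF sym_rtrancl[OF sym_adjacency]])
    with \<open>(u, lab l u) \<in> ?R\<close> show ?thesis by (rule rtrancl_trans)
  qed
  then show ?thesis unfolding connected_spanning_def using maker_edges_subset by blast
qed

lemma blocked_class:
  assumes inv: "invariant l" and cand: "candidates n (lab l) \<noteq> {}" and blocked: "\<not> good_step l"
  defines "k \<equiv> card {u. u < n \<and> lab l u = target l}"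
  shows "1 \<le> k" "2 * k \<le> n" "Suc l < n" "k * (n - k) \<le> b * (l div a + 1)"
    "n - k \<le> edge_degree (breaker l) (target l)"
proof -
  let ?w = "target l" and ?C = "{u. u < n \<and> lab l u = target l}"
  let ?D = "{..<n} - ?C"
  have w: "?w \<in> lab l ` {..<n}" and k2: "2 * k \<le> n"
    using target_candidate[OF cand] by (auto simp: candidates_def k_def)
  then have wC: "?w \<in> ?C" using inv by (auto simp: invariant_def)
  have "card {?w} \<le> k" unfolding k_def by (rule card_mono) (use wC in auto)
  then have k1: "1 \<le> k" by simp
  have card_D: "card ?D = n - k" unfolding k_def by (subst card_Diff_subset) auto
  have cut: "{x, y} \<in> breaker l" if x: "x \<in> ?C" and y: "y \<in> ?D" for x y
  proof (rule ccontr)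
    assume "{x, y} \<notin> breaker l"
    moreover have "x \<noteq> y" using x y by auto
    then have "{x, y} \<in> complete_edges n" using x y by (auto simp: complete_edges_def)
    moreover have "lab l x \<noteq> lab l y" using x y by auto
    then have "{x, y} \<notin> medges l" using inv unfolding invariant_def by blast
    ultimately have "{x, y} \<in> free_edges n (breaker l) (medges l)" by (simp add: free_edges_def)
    then have "{x, y} \<in> crossing n (breaker l) (medges l) (lab l) ?w"
      using x y by (auto simp: crossing_def)
    then show False using blocked cand unfolding good_step_def by blast
  qed
  have inj: "inj_on (\<lambda>(x, y). {x, y}) (?C \<times> ?D)"
    by (auto simp: inj_on_def doubleton_eq_iff)
  have "k * (n - k) = card ((\<lambda>(x, y). {x, y}) ` (?C \<times> ?D))"
    unfolding card_image[OF inj] card_cartesian_product card_D k_def ..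
  also have "\<dots> \<le> card (breaker l)"
    by (rule card_mono[OF finite_breaker]) (use cut in auto)
  also have "\<dots> \<le> (\<Sum>i\<le>l div a. card (X i))" by (rule card_UN_le) simp
  also have "\<dots> \<le> (\<Sum>i\<le>l div a. b)" by (rule sum_mono) (rule card_X)
  finally show "k * (n - k) \<le> b * (l div a + 1)" by (simp add: mult.commute)
  have "n - k = card ((\<lambda>y. {?w, y}) ` ?D)"
    unfolding card_D[symmetric] using wC
    by (subst card_image) (auto simp: inj_on_def doubleton_eq_iff)
  also have "\<dots> \<le> edge_degree (breaker l) ?w"
    unfolding edge_degree_def
  proof (rule card_mono)
    show "(\<lambda>y. {?w, y}) ` ?D \<subseteq> {f \<in> breaker l. ?w \<in> f}"
      using cut[OF wC] by blast
    show "finite {f \<in> breaker l. ?w \<in> f}" using finite_breaker by simp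
  qed
  finally show "n - k \<le> edge_degree (breaker l) ?w" .
  have "card ?D > 0" unfolding card_D using k1 k2 by linarith
  then obtain y where y: "y \<in> ?D" by (metis card.empty ex_in_conv less_irrefl)
  then have "card {?w, lab l y} = 2" by auto
  moreover have "card {?w, lab l y} \<le> card (lab l ` {..<n})"
    by (rule card_mono) (use w y in auto)
  ultimately show "Suc l < n" using inv unfolding invariant_def by linarith
  show "1 \<le> k" "2 * k \<le> n" by fact+
qed

lemma run_outcome:
  obtains l where "connected_spanning n (medges l)"
  | m k where "1 \<le> m" "m < n" "1 \<le> k" "2 * k \<le> n" "k * (n - k) \<le> b * ((m - 1) div a + 1)"
      "\<And>R0. R0 * a < m \<Longrightarrow> real n - real k
          \<le> real b * (\<Sum>r\<le>(m - 1) div a. 1 / real (m - r * a))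
            + real b * (\<Sum>r<R0. 1 / real (m - r * a)) + real (m - R0 * a - 1)"
proof -
  have "\<exists>l. \<not> good_step l"
  proof (rule ccontr)
    assume "\<nexists>l. \<not> good_step l"
    then have "invariant (Suc n)" by (intro invariant_good) auto
    then show False by (simp add: invariant_def)
  qed
  then obtain l where bad: "\<not> good_step l" and good: "\<And>i. i < l \<Longrightarrow> good_step i"
    using exists_least_iff[of "\<lambda>l. \<not> good_step l"] by blast
  have inv: "invariant l" using good by (rule invariant_good)
  show ?thesis
  proof (cases "candidates n (lab l) = {}")
    case True
    then show ?thesis using connected_if_no_candidates[OF inv] that(1) by blast
  next
    case cand: False
    have target_mem: "target j \<in> candidates n (lab i)" if "i \<le> j" "j \<le> l" for i j
    proof -
      have "candidates n (lab j) \<noteq> {}" using cand good that unfolding good_step_def by (cases "j = l") auto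
      then show ?thesis
        using target_candidate candidates_antimono[of j i] good that by (meson less_le_trans subsetD)
    qed
    have ne: "target i \<noteq> target j" if "i < j" "j \<le> l" for i j
      using target_mem[of "Suc i" j] candidates_good_step[of i] good[of i] that by auto
    interpret greedy_sequence target X "Suc l" a b
    proof
      show "inj_on target {..<Suc l}"
      proof (rule inj_onI)
        fix i j assume "i \<in> {..<Suc l}" "j \<in> {..<Suc l}" "target i = target j"
        then show "i = j" using ne[of i j] ne[of j i] by (cases i j rule: linorder_cases) auto
      qed
      show "finite (X r)" for r using X_subset finite_subset[OF _ finite_complete_edges] by blast
      show "card f = 2" if "f \<in> X r" for f r using X_subset that by (auto simp: complete_edges_def)
      fix i j assume ij: "i \<le> j" "j < Suc l"
      show "edge_degree (breaker i) (target j) \<le> edge_degree (breaker i) (target i)"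
        unfolding target_def[of i]
        by (rule pick_candidate(2)) (use target_mem[of i j] finite_breaker ij in auto)
    qed (use a_pos X_disjoint card_X in auto)
    let ?k = "card {u. u < n \<and> lab l u = target l}"
    note block = blocked_class[OF inv cand bad]
    show ?thesis
    proof (rule that(2)[of "Suc l" ?k])
      fix R0 assume "R0 * a < Suc l"
      note last_degree_le[OF this]
      moreover have "real n - real ?k \<le> real (edge_degree (breaker l) (target l))"
        using block(5) by linarith
      ultimately show "real n - real ?k
          \<le> real b * (\<Sum>r\<le>(Suc l - 1) div a. 1 / real (Suc l - r * a))
            + real b * (\<Sum>r<R0. 1 / real (Suc l - r * a)) + real (Suc l - R0 * a - 1)"
        by (simp only: diff_Suc_1)
    qed (use block in auto)
  qed
qed

end

section \<open>Estimates\<close>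

lemma harmonic_tail_le:
  assumes "1 \<le> p" "p \<le> N"
  shows "(\<Sum>q\<in>{p<..N}. 1 / real q) \<le> ln (real N / real p)"
  using assms(2)
proof (induction N rule: dec_induct)
  case base
  then show ?case using assms by simp
next
  case (step N)
  have pos: "0 < real N" "0 < real p" using assms step by auto
  have "ln (real N / real (Suc N)) \<le> real N / real (Suc N) - 1"
    using pos by (intro ln_le_minus_one) simp
  also have "\<dots> = - (1 / real (Suc N))" by (simp add: field_simps)
  finally have "1 / real (Suc N) \<le> ln (real (Suc N)) - ln (real N)" using pos by (simp add: ln_div)
  moreover have "{p<..Suc N} = insert (Suc N) {p<..N}" using step by auto
  ultimately show ?case using step.IH pos by (simp add: ln_div)
qed

lemma harmonic_le:
  assumes "1 \<le> y" "real R \<le> y"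
  shows "(\<Sum>q\<in>{0<..R}. 1 / real q) \<le> 1 + ln y"
proof (cases "R = 0")
  case True
  then show ?thesis using assms by simp
next
  case False
  then have "{0<..R} = insert 1 {1<..R}" by auto
  then have "(\<Sum>q\<in>{0<..R}. 1 / real q) = 1 + (\<Sum>q\<in>{1<..R}. 1 / real q)" by simp
  also have "\<dots> \<le> 1 + ln (real R)" using harmonic_tail_le[of 1 R] False by simp
  also have "\<dots> \<le> 1 + ln y" using assms False by simp
  finally show ?thesis .
qed

lemma turn_sum_le:
  fixes a m p :: nat
  assumes a: "0 < a" and m: "1 \<le> m"
  defines "R \<equiv> (m - 1) div a"
  defines "t \<equiv> m - R * a"
  shows "1 \<le> t" "t \<le> a" "R * a + t = m"
    and "(\<Sum>r\<le>R. 1 / real (m - r * a)) \<le> 1 / real t + (\<Sum>q\<in>{0<..R}. 1 / real q) / real a"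
    and "(\<Sum>r<R - p. 1 / real (m - r * a)) \<le> (\<Sum>q\<in>{p<..R}. 1 / real q) / real a"
proof -
  have "m - 1 = R * a + (m - 1) mod a" unfolding R_def by simp
  moreover have "(m - 1) mod a < a" using a by simp
  ultimately show t: "1 \<le> t" "t \<le> a" "R * a + t = m" using m unfolding t_def by linarith+
  have le: "(\<Sum>r<R - p. 1 / real (m - r * a)) \<le> (\<Sum>q\<in>{p<..R}. 1 / real q) / real a" for p
  proof -
    have "(\<Sum>r<R - p. 1 / real (m - r * a)) = (\<Sum>q\<in>{p<..R}. 1 / real (m - (R - q) * a))"
      by (rule sum.reindex_bij_witness[where i = "\<lambda>q. R - q" and j = "\<lambda>r. R - r"]) auto
    also have "\<dots> \<le> (\<Sum>q\<in>{p<..R}. 1 / real q / real a)"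
    proof (rule sum_mono)
      fix q assume q: "q \<in> {p<..R}"
      have "(R - q) * a + q * a = R * a" using q by (simp add: add_mult_distrib[symmetric])
      then have "q * a \<le> m - (R - q) * a" using t(3) by linarith
      then have "real q * real a \<le> real (m - (R - q) * a)" unfolding of_nat_mult[symmetric] of_nat_le_iff .
      moreover have "0 < real q * real a" using q a by simp
      ultimately have "1 / real (m - (R - q) * a) \<le> 1 / (real q * real a)"
        by (intro frac_le) (simp_all del: of_nat_diff)
      then show "1 / real (m - (R - q) * a) \<le> 1 / real q / real a" by simp
    qed
    finally show ?thesis by (simp add: sum_divide_distrib)
  qed
  then show "(\<Sum>r<R - p. 1 / real (m - r * a)) \<le> (\<Sum>q\<in>{p<..R}. 1 / real q) / real a" .
  have "(\<Sum>r\<le>R. 1 / real (m - r * a)) = (\<Sum>r<R. 1 / real (m - r * a)) + 1 / real t"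
    unfolding t_def lessThan_Suc_atMost[symmetric] by simp
  then show "(\<Sum>r\<le>R. 1 / real (m - r * a)) \<le> 1 / real t + (\<Sum>q\<in>{0<..R}. 1 / real q) / real a"
    using le[of 0] by simp
qed

lemma not_makers_win_bounds:
  fixes n a b :: nat
  assumes a: "0 < a" "a \<le> n" and lose: "\<not> connectivity_makers_win n a b"
  defines "y \<equiv> real b / real a"
  obtains t k :: nat where "1 \<le> t" "t \<le> a" "1 \<le> k" "2 * k \<le> n"
    "real k * (real n - real k) \<le> y * (real n + real a)"
    "real n - real k \<le> real b / real t + y * (2 + 2 * ln (real n / real a)) + real t - 1"
    "\<And>z. 0 < z \<Longrightarrow> z \<le> real n \<Longrightarrow>
       real n - real k \<le> real b / real t + y * (1 + ln (real n / real a)) + real t - 1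
         + z + real a + y * ln (real n / z)"
proof -
  let ?s = "maker_strategy n a"
  obtain \<tau> where \<tau>: "legal_strategy (complete_edges n) b \<tau>"
    and lose: "\<not> connected_spanning n (maker_claims ?s \<tau>)"
    using lose legal_maker_strategy unfolding connectivity_makers_win_def makers_win_def by blast
  define X where "X i = \<tau> (play ?s \<tau> (2 * i))" for i
  have X: "X i \<subseteq> complete_edges n - \<Union>(set (play ?s \<tau> (2 * i)))" "card (X i) \<le> b" for i
    using \<tau> unfolding legal_strategy_def X_def by auto
  have disj: "X i \<inter> X j = {}" if "i < j" for i j
    using X(1)[of j] Union_play_even[OF a(1), where n = n and \<tau> = \<tau> and i = j] that
    unfolding X_def by blast
  interpret maker_run n a b X
  proof
    show "X r \<inter> X s = {}" if "r \<noteq> s" for r s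
      using disj[of r s] disj[of s r] that by (cases r s rule: linorder_cases) auto
  qed (use a X in auto)
  have claims: "maker_claims ?s \<tau> \<subseteq> complete_edges n"
    using legal_maker_strategy[of n a] unfolding maker_claims_def legal_strategy_def by blast
  have "\<not> connected_spanning n (medges l)" for l
  proof
    assume conn: "connected_spanning n (medges l)"
    have "medges l \<subseteq> maker_claims ?s \<tau>"
      using maker_edges_subset_claims[OF a(1), where n = n and \<tau> = \<tau> and l = l] unfolding X_def .
    then have "{(x, y). {x, y} \<in> medges l}\<^sup>* \<subseteq> {(x, y). {x, y} \<in> maker_claims ?s \<tau>}\<^sup>*"
      by (intro rtrancl_mono) auto
    then have "connected_spanning n (maker_claims ?s \<tau>)"
      using conn claims unfolding connected_spanning_def by blast
    then show False using lose by simp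
  qed
  then obtain m k where m: "1 \<le> m" "m < n" and k: "1 \<le> k" "2 * k \<le> n"
    and cut: "k * (n - k) \<le> b * ((m - 1) div a + 1)"
    and deg: "\<And>R0. R0 * a < m \<Longrightarrow> real n - real k
          \<le> real b * (\<Sum>r\<le>(m - 1) div a. 1 / real (m - r * a))
            + real b * (\<Sum>r<R0. 1 / real (m - r * a)) + real (m - R0 * a - 1)"
    using run_outcome by metis
  define R where "R = (m - 1) div a"
  define t where "t = m - R * a"
  note sums = turn_sum_le[OF a(1) m(1), folded R_def, folded t_def]
  have a0: "0 < real a" using a by simp
  have y: "0 \<le> y" "real b = y * real a" using a by (simp_all add: y_def)
  have Ra: "R * a \<le> n" using sums(3) m by linarith
  then have "real R * real a \<le> real n" unfolding of_nat_mult[symmetric] of_nat_le_iff .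
  then have R: "real R \<le> real n / real a" using a0 by (simp add: field_simps)
  have na: "1 \<le> real n / real a" using a by simp
  note harmonic = harmonic_le[OF na R]
  have main: "real n - real k \<le> real b / real t + y * (1 + ln (real n / real a))
       + y * (\<Sum>q\<in>{p<..R}. 1 / real q) + real (p * a) + real t - 1" for p
  proof -
    have "(R - p) * a \<le> R * a" by simp
    then have "(R - p) * a < m" using sums(1,3) by linarith
    note deg[OF this, folded R_def]
    moreover have "real b * (\<Sum>r\<le>R. 1 / real (m - r * a)) \<le> real b / real t + y * (1 + ln (real n / real a))"
    proof -
      have "(\<Sum>r\<le>R. 1 / real (m - r * a)) \<le> 1 / real t + (1 + ln (real n / real a)) / real a"
        by (intro order.trans[OF sums(4)] add_left_mono divide_right_mono harmonic) simp
      then have "real b * (\<Sum>r\<le>R. 1 / real (m - r * a)) \<le> real b * (1 / real t + (1 + ln (real n / real a)) / real a)"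
        by (rule mult_left_mono) simp
      then show ?thesis unfolding y_def by (simp add: distrib_left add_divide_distrib)
    qed
    moreover have "real b * (\<Sum>r<R - p. 1 / real (m - r * a)) \<le> y * (\<Sum>q\<in>{p<..R}. 1 / real q)"
      using mult_left_mono[OF sums(5), of "real b" p] unfolding y_def by simp
    moreover have "real (m - (R - p) * a - 1) \<le> real (p * a) + real t - 1"
    proof -
      have "R * a \<le> (R - p) * a + p * a" unfolding add_mult_distrib[symmetric] by (rule mult_le_mono1) linarith
      then have "m - (R - p) * a - 1 + 1 \<le> p * a + t" using sums(1,3) by linarith
      then have "real (m - (R - p) * a - 1 + 1) \<le> real (p * a + t)" unfolding of_nat_le_iff .
      then show ?thesis unfolding of_nat_add by simp
    qed
    ultimately show ?thesis by linarith
  qed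
  show ?thesis
  proof (rule that[of t k])
    show "real k * (real n - real k) \<le> y * (real n + real a)"
    proof -
      have "real k * (real n - real k) = real (k * (n - k))" using k by (simp add: of_nat_diff)
      also have "\<dots> \<le> real (b * (R + 1))" using cut unfolding R_def of_nat_le_iff .
      also have "\<dots> = y * (real R * real a + real a)" unfolding of_nat_mult y(2) by (simp add: algebra_simps)
      also have "\<dots> \<le> y * (real n + real a)"
        using \<open>real R * real a \<le> real n\<close> y(1) by (intro mult_left_mono) auto
      finally show ?thesis .
    qed
    have "y * (\<Sum>q\<in>{0<..R}. 1 / real q) \<le> y * (1 + ln (real n / real a))"
      by (rule mult_left_mono[OF harmonic y(1)])
    then show "real n - real k \<le> real b / real t + y * (2 + 2 * ln (real n / real a)) + real t - 1"
      using main[of 0] by (simp add: distrib_left)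
    fix z :: real assume z: "0 < z" "z \<le> real n"
    define p where "p = nat \<lceil>z / real a\<rceil>"
    have p: "z / real a \<le> real p" unfolding p_def by linarith
    have p': "real p \<le> z / real a + 1" unfolding p_def using z a0 by (simp add: of_nat_nat)
    have "0 < real p" using p z a0 by (meson divide_pos_pos less_le_trans)
    have "(\<Sum>q\<in>{p<..R}. 1 / real q) \<le> ln (real n / z)"
    proof (cases "p \<le> R")
      case True
      have "(\<Sum>q\<in>{p<..R}. 1 / real q) \<le> ln (real R / real p)"
        using True \<open>0 < real p\<close> by (intro harmonic_tail_le) auto
      also have "real R / real p \<le> (real n / real a) / (z / real a)"
        by (rule frac_le) (use R p z a0 in auto)
      then have "ln (real R / real p) \<le> ln (real n / z)"
        using True \<open>0 < real p\<close> a0 by (subst ln_le_cancel_iff) (use z in auto)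
      finally show ?thesis .
    next
      case False
      then show ?thesis using z by simp
    qed
    then have "y * (\<Sum>q\<in>{p<..R}. 1 / real q) \<le> y * ln (real n / z)" using y(1) by (rule mult_left_mono)
    moreover have "real (p * a) \<le> z + real a" using p' a0 by (simp add: field_simps)
    ultimately show "real n - real k \<le> real b / real t + y * (1 + ln (real n / real a)) + real t - 1
         + z + real a + y * ln (real n / z)"
      using main[of p] by linarith
  qed (use sums k in auto)
qed

lemma class_size_le:
  fixes n k a :: nat and y :: real
  assumes "2 * k \<le> n" "2 * a \<le> n" "1 \<le> k" and y: "0 \<le> y" "48 * y \<le> real n"
    and cut: "real k * (real n - real k) \<le> y * (real n + real a)"
  shows "real k \<le> 16 / 10 * y"
proof -
  have n: "0 < real n" using assms by linarith
  have "y * (real n + real a) \<le> y * (3 / 2 * real n)"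
    using y(1) assms(2) by (intro mult_left_mono) linarith+
  with cut have c: "real k * (real n - real k) \<le> 3 / 2 * y * real n" by simp
  have "real k * (real n / 2) \<le> real k * (real n - real k)"
    using assms(1) by (intro mult_left_mono) linarith+
  with c have "real k / 2 * real n \<le> 3 / 2 * y * real n" by (simp add: mult.commute)
  then have "real k / 2 \<le> 3 / 2 * y" using n by (simp add: mult_le_cancel_right)
  then have "16 * real k \<le> real n" using y by linarith
  then have "real k * (15 / 16 * real n) \<le> real k * (real n - real k)"
    by (intro mult_left_mono) linarith+
  moreover have "real k * (15 / 16 * real n) = 15 / 16 * real k * real n" by simp
  ultimately have "15 / 16 * real k * real n \<le> 3 / 2 * y * real n" using c by linarith
  then have "15 / 16 * real k \<le> 3 / 2 * y" using n by (simp add: mult_le_cancel_right)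
  then show ?thesis by linarith
qed

lemma connectivity_makers_win_small_bias:
  fixes n a b :: nat
  defines "L \<equiv> ln (real n)"
  assumes a: "0 < a" and L: "96 \<le> L" "ln L + 4 \<le> L / 10" "ln (1 + L) \<le> ln L + 1 / 10"
    and small: "real a * L * (real a + L) \<le> real n / 100"
    and b: "real b < real a * (real n - real n / (real a * L)
                + (real a - 1) / 2 * ln (real n / ((real a)\<^sup>2 * L))) / (L + real a + ln L + 4)"
  shows "connectivity_makers_win n a b"
proof (rule ccontr)
  assume lose: "\<not> connectivity_makers_win n a b"
  define y where "y = real b / real a"
  define W where "W = real a + L"
  define x where "x = real n / W"
  define D where "D = W + ln L + 4"
  have a1: "1 \<le> real a" using a by simp
  have L0: "0 < L" "0 \<le> ln L" using L(1) by auto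
  have n0: "0 < real n" using L(1) unfolding L_def by (cases "n = 0") auto
  have W: "97 \<le> W" "0 < W" using a1 L(1) unfolding W_def by linarith+
  have D: "96 \<le> D" "D \<le> 11 / 10 * W" "0 < D"
    using W L(2) L0 a1 unfolding D_def W_def by (auto simp: field_simps)
  have x: "0 < x" "x \<le> real n" "real n / x = W"
    unfolding x_def using n0 W by (auto simp: divide_le_eq)
  have aLx: "real a * L \<le> x / 100"
    using small W(2) unfolding x_def W_def by (simp add: field_simps)
  have "real a * 1 \<le> real a * L" using L(1) by (intro mult_left_mono) auto
  then have ax: "real a \<le> x / 100" using aLx by simp
  then have an: "2 * a \<le> n" "a \<le> n" using x by linarith+
  have y0: "0 \<le> y" and ya: "real b = y * real a" using a1 by (auto simp: y_def)
  have a2L: "1 \<le> (real a)\<^sup>2 * L"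
    using mult_mono[of 1 "(real a)\<^sup>2" 1 L] a1 L(1) by (simp add: one_le_power)
  have "real n / ((real a)\<^sup>2 * L) \<le> real n / 1"
    using a2L n0 by (intro divide_left_mono) auto
  then have "ln (real n / ((real a)\<^sup>2 * L)) \<le> L"
    unfolding L_def[symmetric] using n0 a2L by (subst L_def, subst ln_le_cancel_iff) auto
  then have "(real a - 1) / 2 * ln (real n / ((real a)\<^sup>2 * L)) \<le> (real a - 1) / 2 * L"
    using a1 by (intro mult_left_mono) auto
  also have "\<dots> \<le> real a * L / 2" using L0 by (simp add: field_simps)
  finally have gain: "(real a - 1) / 2 * ln (real n / ((real a)\<^sup>2 * L)) \<le> real a * L / 2" .
  have "L + real a + ln L + 4 = D" by (simp add: D_def W_def)
  from b[unfolded this pos_less_divide_eq[OF D(3)]]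
  have "real a * (y * D) < real a * (real n - real n / (real a * L)
                + (real a - 1) / 2 * ln (real n / ((real a)\<^sup>2 * L)))"
    unfolding ya by (simp add: algebra_simps)
  then have "y * D < real n - real n / (real a * L)
                + (real a - 1) / 2 * ln (real n / ((real a)\<^sup>2 * L))"
    using a1 by (simp only: mult_less_cancel_left_pos)
  moreover have "0 \<le> real n / (real a * L)" using L0 by simp
  ultimately have yD: "y * D < real n + x / 200" using gain aLx by linarith
  have "y * 96 \<le> y * D" using D y0 by (intro mult_left_mono) auto
  then have yn: "48 * y \<le> real n" using yD x by linarith
  obtain t k :: nat where t: "1 \<le> t" "t \<le> a" and k: "1 \<le> k" "2 * k \<le> n"
    and cut: "real k * (real n - real k) \<le> y * (real n + real a)"
    and deg: "\<And>z. 0 < z \<Longrightarrow> z \<le> real n \<Longrightarrow>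
       real n - real k \<le> real b / real t + y * (1 + ln (real n / real a)) + real t - 1
         + z + real a + y * ln (real n / z)"
    using not_makers_win_bounds[OF a an(2) lose, folded y_def] by metis
  have ky: "real k \<le> 16 / 10 * y" by (rule class_size_le[OF k(2) an(1) k(1) y0 yn cut])
  have bt: "real b / real t \<le> y * real a" unfolding ya[symmetric] using t divide_left_mono[of 1 "real t" "real b"] by simp
  have lna: "ln (real n / real a) = L - ln (real a)" unfolding L_def using n0 a1 by (simp add: ln_div)
  have "W \<le> real a * (1 + L)" unfolding W_def using mult_right_mono[of 1 "real a" L] a1 L0 by (simp add: distrib_left)
  then have "ln W \<le> ln (real a * (1 + L))" using W by simp
  also have "\<dots> = ln (real a) + ln (1 + L)" using a1 L0 by (subst ln_mult_pos) auto
  finally have lnW: "ln W \<le> ln (real a) + ln L + 1 / 10" using L(3) by linarith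
  have "y * ln W \<le> y * (ln (real a) + ln L + 1 / 10)" by (rule mult_left_mono[OF lnW y0])
  with deg[OF x(1,2)] have "real n \<le> 16 / 10 * y + y * real a + y * (1 + (L - ln (real a))) + x + 2 * real a
      + y * (ln (real a) + ln L + 1 / 10)"
    using ky bt t unfolding x(3) lna by linarith
  also have "\<dots> = y * (D - 13 / 10) + x + 2 * real a"
    unfolding D_def W_def by (simp add: algebra_simps)
  finally have final: "real n \<le> y * (D - 13 / 10) + x + 2 * real a" .
  have "y * (D - 13 / 10) = y * D * (1 - 13 / 10 / D)" using D by (simp add: field_simps)
  also have "\<dots> \<le> (real n + x / 200) * (1 - 13 / 10 / D)"
    using yD D by (intro mult_right_mono) auto
  also have "\<dots> = real n + x / 200 - 13 / 10 * ((real n + x / 200) / D)"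
    by (simp add: algebra_simps add_divide_distrib)
  also have "\<dots> \<le> real n + x / 200 - 118 / 100 * x"
  proof -
    have "10 / 11 * x = real n / (11 / 10 * W)" by (simp add: x_def)
    also have "\<dots> \<le> (real n + x / 200) / D" using D x n0 by (intro frac_le) auto
    finally show ?thesis using x by linarith
  qed
  finally show False using final ax x by linarith
qed

lemma connectivity_makers_win_large_bias:
  fixes n a b :: nat
  assumes a: "0 < a" "2 * a \<le> n" and n: "1 \<le> ln (real n)" and large: "8 * (4 + 2 * ln (real n)) \<le> real a"
    and b: "real b < real a * real n / (real a + 2 * ln (real n) - 2 * ln (real a) + 4)"
  shows "connectivity_makers_win n a b"
proof (rule ccontr)
  assume lose: "\<not> connectivity_makers_win n a b"
  define y where "y = real b / real a"
  define l where "l = ln (real n / real a)"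
  have an: "a \<le> n" using a by simp
  have "48 \<le> 8 * (4 + 2 * u)" if "1 \<le> u" for u :: real using that by simp
  from this[OF n]
  have a48: "48 \<le> real a" using large by (rule order.trans)
  have a1: "1 \<le> real a" and n96: "96 \<le> real n" and n0: "0 < real n" using a a48 by simp_all
  have l: "0 \<le> l" "l \<le> ln (real n)" and l_eq: "l = ln (real n) - ln (real a)"
    unfolding l_def using a1 an n0 by (auto simp: ln_div)
  have y0: "0 \<le> y" and ya: "real b = y * real a" using a1 by (auto simp: y_def)
  have "real b * (real a + 2 * l + 4) < real a * real n"
    using b l(1) a1 unfolding l_eq by (simp add: field_simps)
  then have "real a * (y * (real a + 2 * l + 4)) < real a * real n"
    unfolding ya by (simp add: algebra_simps)
  then have less: "y * (real a + 2 * l + 4) < real n"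
    using a1 by (simp only: mult_less_cancel_left_pos)
  have nonneg: "0 \<le> y * (2 * l + 4)" using y0 l by simp
  have "y * (real a + 2 * l + 4) = y * real a + y * (2 * l + 4)" by (simp add: algebra_simps)
  then have ya_n: "y * real a < real n" using less nonneg by linarith
  have "y * 48 \<le> y * real a" using y0 a48 by (intro mult_left_mono) auto
  then have yn: "48 * y \<le> real n" using ya_n by linarith
  have "y * (8 * (4 + 2 * l)) \<le> y * real a" using large l y0 by (intro mult_left_mono) auto
  then have y8: "y * (4 + 2 * l) \<le> real n / 8" using ya_n by (simp add: algebra_simps)
  obtain t k :: nat where t: "1 \<le> t" "t \<le> a" and k: "1 \<le> k" "2 * k \<le> n"
    and cut: "real k * (real n - real k) \<le> y * (real n + real a)"
    and deg: "real n - real k \<le> real b / real t + y * (2 + 2 * l) + real t - 1"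
    using not_makers_win_bounds[OF a(1) an lose, folded y_def l_def] by metis
  have ky: "real k \<le> 16 / 10 * y" by (rule class_size_le[OF k(2) a(2) k(1) y0 yn cut])
  have sum: "y * (2 + 2 * l) + 2 * y = y * (4 + 2 * l)" by (simp add: algebra_simps)
  consider "t = 1" | "t = 2" | "3 \<le> t" using t by linarith
  then show False
  proof cases
    case 1
    then have "real n \<le> y * real a + y * (4 + 2 * l)" using deg ky sum y0 ya by simp
    then show False using less by (simp add: algebra_simps)
  next
    case 2
    then show False using deg ky sum y8 y0 ya_n ya n96 by simp
  next
    case 3
    have "real b / real t \<le> real b / 3" using 3 by (intro divide_left_mono) auto
    then show False using deg ky sum y8 y0 ya_n ya t(2) a(2) n0 by linarith
  qed
qed

theorem theorem1p4:
  fixes a b :: "nat \<Rightarrow> nat"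
  assumes "\<And>n. 0 < a n" and "\<And>n. 0 < b n"
  shows
    "((\<lambda>n. real (a n)) \<in> o(\<lambda>n. sqrt (real n / ln (real n))) \<longrightarrow>
        (\<forall>\<^sub>F n in sequentially.
           real (b n) <
             real (a n) * (real n - real n / (real (a n) * ln (real n))
                 + (real (a n) - 1) / 2 * ln (real n / ((real (a n))\<^sup>2 * ln (real n))))
               / (ln (real n) + real (a n) + ln (ln (real n)) + 4)
           \<longrightarrow> connectivity_makers_win n (a n) (b n)))
     \<and> ((\<lambda>n. real (a n)) \<in> \<Omega>(\<lambda>n. sqrt (real n / ln (real n))) \<longrightarrow>
        (\<forall>\<^sub>F n in sequentially.
           real (a n) \<le> (real n - 1) / 2 \<and>
           real (b n) < real (a n) * real n
               / (real (a n) + 2 * ln (real n) - 2 * ln (real (a n)) + 4)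
           \<longrightarrow> connectivity_makers_win n (a n) (b n)))"
proof (intro conjI impI)
  assume "(\<lambda>n. real (a n)) \<in> o(\<lambda>n. sqrt (real n / ln (real n)))"
  then have "\<forall>\<^sub>F n in sequentially. norm (real (a n)) \<le> 1 / 20 * norm (sqrt (real n / ln (real n)))"
    by (rule landau_o.smallD) simp
  moreover have "\<forall>\<^sub>F n in sequentially. 96 \<le> ln (real n)" by real_asymp
  moreover have "\<forall>\<^sub>F n in sequentially. ln (ln (real n)) + 4 \<le> ln (real n) / 10" by real_asymp
  moreover have "\<forall>\<^sub>F n in sequentially. ln (1 + ln (real n)) \<le> ln (ln (real n)) + 1 / 10" by real_asymp
  moreover have "\<forall>\<^sub>F n in sequentially. sqrt (real n / ln (real n)) * (ln (real n))\<^sup>2 \<le> real n / 20" by real_asymp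
  ultimately show "\<forall>\<^sub>F n in sequentially.
           real (b n) <
             real (a n) * (real n - real n / (real (a n) * ln (real n))
                 + (real (a n) - 1) / 2 * ln (real n / ((real (a n))\<^sup>2 * ln (real n))))
               / (ln (real n) + real (a n) + ln (ln (real n)) + 4)
           \<longrightarrow> connectivity_makers_win n (a n) (b n)"
  proof eventually_elim
    case (elim n)
    let ?L = "ln (real n)" and ?s = "sqrt (real n / ln (real n))"
    have s: "0 \<le> ?s" "?s\<^sup>2 * ?L = real n" using elim(2) by auto
    have le: "real (a n) \<le> 1 / 20 * ?s" using elim(1) s by simp
    have "(real (a n))\<^sup>2 \<le> (1 / 20 * ?s)\<^sup>2" using le by (intro power_mono) auto
    then have "(real (a n))\<^sup>2 * ?L \<le> (1 / 20 * ?s)\<^sup>2 * ?L" using elim(2) by (intro mult_right_mono) auto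
    also have "\<dots> = real n / 400" using s(2) by (simp add: power_mult_distrib power2_eq_square)
    finally have 1: "(real (a n))\<^sup>2 * ?L \<le> real n / 400" .
    have "real (a n) * ?L\<^sup>2 \<le> 1 / 20 * ?s * ?L\<^sup>2" by (intro mult_right_mono le) simp
    then have 2: "real (a n) * ?L\<^sup>2 \<le> real n / 400" using elim(5) by simp
    have "real (a n) * ?L * (real (a n) + ?L) = (real (a n))\<^sup>2 * ?L + real (a n) * ?L\<^sup>2"
      by (simp add: power2_eq_square algebra_simps)
    then have "real (a n) * ?L * (real (a n) + ?L) \<le> real n / 100" using 1 2 by linarith
    then show ?case
      using connectivity_makers_win_small_bias[OF assms(1) elim(2-4)] by blast
  qed
next
  assume "(\<lambda>n. real (a n)) \<in> \<Omega>(\<lambda>n. sqrt (real n / ln (real n)))"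
  then obtain c where c: "0 < c"
    and ev: "\<forall>\<^sub>F n in sequentially. norm (real (a n)) \<ge> c * norm (sqrt (real n / ln (real n)))"
    by (rule landau_omega.bigE)
  note ev
  moreover have "\<forall>\<^sub>F n in sequentially. 8 * (4 + 2 * ln (real n)) \<le> c * sqrt (real n / ln (real n))"
    using c by real_asymp
  moreover have "\<forall>\<^sub>F n in sequentially. 1 \<le> ln (real n)" by real_asymp
  ultimately show "\<forall>\<^sub>F n in sequentially.
           real (a n) \<le> (real n - 1) / 2 \<and>
           real (b n) < real (a n) * real n
               / (real (a n) + 2 * ln (real n) - 2 * ln (real (a n)) + 4)
           \<longrightarrow> connectivity_makers_win n (a n) (b n)"
  proof eventually_elim
    case (elim n)
    have "c * sqrt (real n / ln (real n)) \<le> c * norm (sqrt (real n / ln (real n)))"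
      using c by (intro mult_left_mono) auto
    then have large: "8 * (4 + 2 * ln (real n)) \<le> real (a n)" using elim by simp
    show ?case
    proof
      assume "real (a n) \<le> (real n - 1) / 2 \<and> real (b n) < real (a n) * real n
               / (real (a n) + 2 * ln (real n) - 2 * ln (real (a n)) + 4)"
      then show "connectivity_makers_win n (a n) (b n)"
        using connectivity_makers_win_large_bias[OF assms(1) _ elim(3) large] by auto
    qed
  qed
qed

end
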